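(* Let $m > 2$ be an odd integer such that $p := 2m+1$ (resp. $p := 2m-1$) is a prime number, and let $S = (s_n)_{n \geq 0}$ be the sequence over $\mathbb{F}_p$ defined by $s_{n+1} = 4 s_n(s_n+1)$, $n \geq 0$, with $s_0 \in D_0 \cap (D_0 - 1)$ (resp. $s_0 \in D_1 \cap (D_0 - 1)$). Let $T$ be the period of $S$. Then $$L(S, N) \geq \frac{\min\{N^2, 4T^2\}}{16 m} - m^{1/2} \quad \text{for all integers } N \geq 1.$$
   Context: $\mathbb{F}_p$ is the finite field with $p$ elements. $D_0, D_1 \subset \mathbb{F}_p$ denote the set of non-zero quadratic residues modulo $p$ and the set of quadratic non-residues modulo $p$, respectively. For an integer $b$, $D_i - b = \{c \in \mathbb{F}_p \mid c + b \in D_i\}$; thus $a \in D_i \cap (D_0 - 1)$ means $a \in D_i$ and $a+1 \in D_0$. Period: for an eventually periodic sequence $S = (s_n)_{n\ge 0}$, let $r$ be the least positive integer with $s_r \in \{s_0,\dots,s_{r-1}\}$ and $t$ the least non-negative integer with $s_r = s_t$; the period of $S$ is $r - t$. For a sequence $S = (s_n)_{n \ge 0}$ over a finite field $\mathbb{F}_q$ and an integer $N \geq 1$, the $N$-th linear complexity $L(S,N)$ is the length $L$ of the shortest linear recurrence relation $s_{n+L} = a_{L-1}s_{n+L-1} + \cdots + a_0 s_n$, $0 \leq n \leq N - L - 1$, for some $a_0,\dots,a_{L-1} \in \mathbb{F}_q$ (the length $L=0$, with empty right-hand side equal to $0$, is allowed; the condition is vacuous if $L \ge N$). *)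

theory Defs
  imports Complex_Main "HOL-Library.Cardinality" "HOL-Computational_Algebra.Primes"
begin

definition quad_residues :: "'a::field set" where
  "quad_residues = {x. x \<noteq> 0 \<and> (\<exists>y. x = y ^ 2)}"

text \<open>Zero is a square, so it lies in neither of the two sets.\<close>

definition quad_nonresidues :: "'a::field set" where
  "quad_nonresidues = {x. \<not> (\<exists>y. x = y ^ 2)}"

definition set_shift :: "'a::ring_1 set \<Rightarrow> int \<Rightarrow> 'a set" where
  "set_shift D b = {c. c + of_int b \<in> D}"

text \<open>The following three are meaningful only for sequences that take some value twice;
  as every sequence over a finite type does.\<close>

definition first_repetition :: "(nat \<Rightarrow> 'a) \<Rightarrow> nat" where
  "first_repetition s = (LEAST r. 0 < r \<and> s r \<in> s ` {..<r})"

definition preperiod :: "(nat \<Rightarrow> 'a) \<Rightarrow> nat" where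
  "preperiod s = (LEAST t. s (first_repetition s) = s t)"

definition seq_period :: "(nat \<Rightarrow> 'a) \<Rightarrow> nat" where
  "seq_period s = first_repetition s - preperiod s"

text \<open>The range \<open>0 \<le> n \<le> N - L - 1\<close> is written \<open>n + L < N\<close>, which avoids truncated subtraction
  and is empty if \<open>L \<ge> N\<close>.\<close>

definition has_linear_recurrence :: "(nat \<Rightarrow> 'a::field) \<Rightarrow> nat \<Rightarrow> nat \<Rightarrow> bool" where
  "has_linear_recurrence s N L \<longleftrightarrow>
     (\<exists>a :: nat \<Rightarrow> 'a. \<forall>n. n + L < N \<longrightarrow> s (n + L) = (\<Sum>i<L. a i * s (n + i)))"

definition linear_complexity :: "(nat \<Rightarrow> 'a::field) \<Rightarrow> nat \<Rightarrow> nat" where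
  "linear_complexity s N = (LEAST L. has_linear_recurrence s N L)"

end

theory Submission
  imports Defs "HOL-Computational_Algebra.Polynomial" "HOL-Number_Theory.Totient"
begin

text \<open>
  Let \<open>V\<^sub>k\<close> be the Dickson polynomials, \<open>V\<^sub>k(u + 1/u) = u\<^sup>k + u\<^sup>-\<^sup>k\<close>. Since \<open>4 s' + 2 = V\<^sub>2(4 s + 2)\<close>
  for consecutive terms \<open>s, s'\<close>, the \<open>n\<close>-th term of the sequence is \<open>(V\<^sub>k(\<xi>) - 2) / 4\<close> with
  \<open>k = 2\<^sup>n\<close> and \<open>\<xi> = 4 s\<^sub>0 + 2\<close>. The hypothesis on \<open>s\<^sub>0\<close> says that \<open>V\<^sub>m(\<xi>) = 2\<close>, so \<open>V\<^sub>k(\<xi>)\<close> depends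
  only on \<open>k\<close> modulo an odd divisor \<open>d\<close> of \<open>m\<close>.

  A recurrence of length \<open>L\<close> makes any \<open>L + 1\<close> shifts of the sequence linearly dependent. Averaging
  over the units \<open>r\<close> modulo \<open>d\<close>, one finds an \<open>r\<close> for which many of the residues \<open>r 2\<^sup>j mod d\<close>,
  \<open>j < N / 2\<close>, are at most \<open>N / 2\<close>; if there were more than \<open>L\<close> of them, the dependence would yield a
  nonzero polynomial with more zeros than its degree. The number of units below \<open>h\<close> is
  \<open>h \<phi>(d) / d\<close> up to the sieve error \<open>2\<^sup>\<omega>\<close>, with \<open>\<omega>\<close> the number of primes dividing \<open>d\<close>, and
  \<open>2\<^sup>\<omega> \<le> 2 \<surd>d\<close> accounts for the term \<open>\<surd>m\<close>.
\<close>

subsection \<open>Dickson polynomials\<close>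

text \<open>Dickson polynomials of the first kind with parameter 1 (\<open>2 T_k(x/2)\<close> in
  Chebyshev terms). The argument may lie in any commutative ring, so
  \<open>dickson k [:0, 1:]\<close> is the polynomial itself.\<close>

fun dickson :: "nat \<Rightarrow> 'a::comm_ring_1 \<Rightarrow> 'a" where
  "dickson 0 x = 2"
| "dickson (Suc 0) x = x"
| "dickson (Suc (Suc n)) x = x * dickson (Suc n) x - dickson n x"

lemma dickson_2_right [simp]: "dickson n 2 = (2 :: 'a::comm_ring_1)"
  by (induction n "2 :: 'a" rule: dickson.induct) auto

text \<open>For \<open>x = u + 1/u\<close> this expands \<open>(u^k + u^-k) (u^n + u^-n)\<close>;
  the induction avoids having to produce \<open>u\<close>.\<close>

lemma dickson_mult_dickson:
  "n \<le> k \<Longrightarrow> dickson k x * dickson n x = dickson (k + n) x + dickson (k - n) x"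
proof (induction n x rule: dickson.induct)
  case (2 x)
  then obtain i where "k = Suc i" by (cases k) auto
  then show ?case by (simp add: mult.commute)
next
  case (3 n x)
  then obtain i where k: "k = Suc (Suc (i + n))"
    by (metis add.commute add_Suc_right le_Suc_ex add_Suc)
  have IH1: "dickson k x * dickson (Suc n) x = dickson (k + Suc n) x + dickson (Suc i) x"
    using 3 k by simp
  have IH2: "dickson k x * dickson n x = dickson (k + n) x + dickson (Suc (Suc i)) x"
    using 3 k by (simp add: Suc_diff_le)
  have "dickson k x * dickson (Suc (Suc n)) x
      = x * (dickson k x * dickson (Suc n) x) - dickson k x * dickson n x"
    by (simp add: algebra_simps)
  also have "\<dots> = dickson (k + Suc (Suc n)) x + dickson i x"
    unfolding IH1 IH2 by (simp add: algebra_simps)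
  finally show ?case using k by simp
qed simp

lemma dickson_mult: "dickson (m * n) x = dickson m (dickson n x)"
proof (induction m "dickson n x" rule: dickson.induct)
  case (3 m)
  have "dickson (Suc m * n) x * dickson n x = dickson (Suc (Suc m) * n) x + dickson (m * n) x"
    by (subst dickson_mult_dickson) (auto simp: algebra_simps)
  with 3 show ?case by (simp add: algebra_simps)
qed auto

lemma dickson_2: "dickson 2 x = x\<^sup>2 - 2"
  by (simp add: numeral_2_eq_2 power2_eq_square)

text \<open>For \<open>x = u + 1/u\<close>, \<open>dickson k x - 2\<close> is the square of
  \<open>u^(k/2) - u^(-k/2)\<close>. The identity links equality of two values to the vanishing of a
  factor on the right.\<close>

lemma dickson_diff_square:
  assumes "b \<le> a"
  shows "(dickson a x - dickson b x)\<^sup>2 = (dickson (a + b) x - 2) * (dickson (a - b) x - 2)"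
proof -
  have double: "dickson (2 * k) x = (dickson k x)\<^sup>2 - 2" for k
    by (simp only: dickson_mult dickson_2)
  have "dickson (a + b) x * dickson (a - b) x = dickson (2 * a) x + dickson (2 * b) x"
    using assms by (subst dickson_mult_dickson) (auto simp: mult_2)
  then have "dickson (a + b) x * dickson (a - b) x = (dickson a x)\<^sup>2 + (dickson b x)\<^sup>2 - 4"
    by (simp add: double)
  moreover have "dickson a x * dickson b x = dickson (a + b) x + dickson (a - b) x"
    using assms by (rule dickson_mult_dickson)
  ultimately show ?thesis
    by (simp add: power2_eq_square algebra_simps)
qed

text \<open>Modulo \<open>q\<close>, \<open>v\<close> and \<open>w\<close> are mutually inverse.
  Taking \<open>q = X\<^sup>2 - s\<close> replaces a quadratic extension; \<open>q = 0\<close> gives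
  an identity in the ring itself.\<close>

lemma dickson_dvd:
  fixes v w q :: "'a::comm_ring_1"
  assumes "q dvd v * w - 1"
  shows "q dvd dickson k (v + w) - v ^ k - w ^ k"
proof (induction k "v + w" rule: dickson.induct)
  case (3 k)
  have "dickson (Suc (Suc k)) (v + w) - v ^ Suc (Suc k) - w ^ Suc (Suc k)
     = (v + w) * (dickson (Suc k) (v + w) - v ^ Suc k - w ^ Suc k)
       - (dickson k (v + w) - v ^ k - w ^ k) + (v * w - 1) * (v ^ k + w ^ k)"
    by (simp add: algebra_simps)
  then show ?case using 3 assms by (metis dvd_add dvd_diff dvd_mult dvd_mult2)
qed auto

lemma dickson_const_poly: "dickson k [:x:] = [:dickson k x:]"
  by (induction k x rule: dickson.induct) (auto simp: numeral_poly)

lemma poly_dickson: "poly (dickson k q) x = dickson k (poly q x)"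
  by (induction k q rule: dickson.induct) auto

lemma degree_dickson_X:
  "degree (dickson k ([:0, 1:] :: 'a::idom poly)) = k" if "(2 :: 'a) \<noteq> 0"
proof -
  have *: "degree (dickson k ([:0, 1:] :: 'a poly)) = k \<and>
    degree (dickson (Suc k) ([:0, 1:] :: 'a poly)) = Suc k"
  proof (induction k)
    case (Suc k)
    have "degree ([:0, 1:] * dickson (Suc k) ([:0, 1:] :: 'a poly)) = Suc (Suc k)"
      using Suc by (subst degree_mult_eq) auto
    then have "degree (dickson (Suc (Suc k)) ([:0, 1:] :: 'a poly)) = Suc (Suc k)"
      using Suc by (simp only: dickson.simps diff_conv_add_uminus)
        (subst degree_add_eq_left, auto)
    with Suc show ?case by simp
  qed auto
  then show ?thesis by blast
qed

section \<open>Dickson values at elements of a finite field\<close>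

lemma finite_field_CHAR_eq_CARD:
  assumes "prime (CARD('a::finite_field))"
  shows "CHAR('a) = CARD('a)"
proof -
  \<comment> \<open>Translation by 1 permutes the field.\<close>
  have "(\<Sum>x\<in>UNIV. x + 1) = (\<Sum>x\<in>UNIV. x :: 'a)"
    by (rule sum.reindex_bij_witness[of _ "\<lambda>x. x - 1" "\<lambda>x. x + 1"]) auto
  then have "of_nat CARD('a) = (0 :: 'a)" by (simp add: sum.distrib)
  then have "CHAR('a) dvd CARD('a)" by (simp add: of_nat_eq_0_iff_char_dvd)
  with assms show ?thesis by (metis CHAR_not_1' One_nat_def prime_nat_iff)
qed

lemma finite_field_power_card_minus_1:
  assumes "x \<noteq> (0 :: 'a::finite_field)"
  shows "x ^ (CARD('a) - 1) = 1"
proof -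
  have "x * x ^ (CARD('a) - 1) = x ^ CARD('a)"
    by (metis power_minus_mult mult.commute zero_less_card_finite)
  also have "\<dots> = x * 1"
    by (simp add: finite_field_power_card_eq_same)
  finally show ?thesis using assms by simp
qed

text \<open>Euler's criterion for nonsquares. If \<open>s ^ k\<close> were 1,
  \<open>X\<^sup>2 - s\<close> would divide \<open>X^(2k) - 1\<close>; having no root itself, it
  would leave all \<open>2k\<close> nonzero elements as roots of a cofactor of degree
  \<open>2k - 2\<close>.\<close>

lemma nonsquare_power_half:
  fixes s :: "'a::finite_field"
  assumes nonsquare: "\<not> (\<exists>y. s = y\<^sup>2)" and card: "CARD('a) = 2 * k + 1"
  shows "s ^ k = - 1"
proof (rule ccontr)
  assume ne: "s ^ k \<noteq> - 1"
  have "s \<noteq> 0" using nonsquare by (metis zero_power2)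
  then have "(s ^ k)\<^sup>2 = 1"
    using finite_field_power_card_minus_1[of s] card by (simp add: mult.commute flip: power_mult)
  with ne have sk: "s ^ k = 1" by (simp add: power2_eq_1_iff)
  define q where "q = [:- s, 0, 1:]"
  have q: "[:0, 1:]\<^sup>2 - [:s:] = q" by (simp add: q_def power2_eq_square)
  have "q dvd ([:0, 1:]\<^sup>2) ^ k - [:s:] ^ k"
    unfolding q[symmetric] by (simp add: power_diff_sumr2)
  moreover have "[:s:] ^ k = 1" using sk by (metis poly_const_pow pCons_one)
  ultimately have "q dvd [:0, 1:] ^ (2 * k) - 1"
    by (simp add: power_mult)
  then obtain g where g: "[:0, 1:] ^ (2 * k) - 1 = q * g" by blast
  have "card {0, 1 :: 'a} \<le> CARD('a)" by (intro card_mono) auto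
  then have "k > 0" using card by (cases k) auto
  have deg: "degree ([:0, 1 :: 'a:] ^ (2 * k) - 1) = 2 * k"
    using \<open>k > 0\<close> by (simp add: diff_conv_add_uminus degree_add_eq_left degree_linear_power
      degree_power_eq del: add_uminus_conv_diff)
  have "g \<noteq> 0" using deg g \<open>k > 0\<close> by auto
  have "degree (q * g) = 2 + degree g"
    using \<open>g \<noteq> 0\<close> by (subst degree_mult_eq) (auto simp: q_def)
  with deg g have dg: "degree g + 2 = 2 * k" by simp
  have "UNIV - {0} \<subseteq> {x. poly g x = 0}"
  proof
    fix x :: 'a assume "x \<in> UNIV - {0}"
    then have "x ^ (2 * k) = 1"
      using finite_field_power_card_minus_1[of x] card by simp
    then have "poly q x * poly g x = 0"
      by (simp flip: poly_mult g)
    moreover have "poly q x \<noteq> 0"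
      using nonsquare by (auto simp: q_def power2_eq_square)
    ultimately show "x \<in> {x. poly g x = 0}" by simp
  qed
  then have "card (UNIV - {0 :: 'a}) \<le> card {x. poly g x = 0}"
    by (intro card_mono) auto
  also have "\<dots> \<le> degree g"
    using \<open>g \<noteq> 0\<close> by (rule card_poly_roots_bound)
  finally show False using card dg by (simp add: card_Diff_singleton)
qed

text \<open>\<open>2 * b\<close> is the sum of the mutually inverse elements \<open>b + a\<close>
  and \<open>b - a\<close>, to which Fermat's theorem applies.\<close>

lemma dickson_eq_2_of_square:
  fixes a b :: "'a::finite_field"
  assumes "b\<^sup>2 = a\<^sup>2 + 1"
  shows "dickson (CARD('a) - 1) (2 * b) = 2"
proof -
  have 1: "(b + a) * (b - a) = 1"
    using assms by (simp add: algebra_simps power2_eq_square)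
  then have "b + a \<noteq> 0" "b - a \<noteq> 0" by auto
  then have "(b + a) ^ (CARD('a) - 1) = 1" "(b - a) ^ (CARD('a) - 1) = 1"
    by (simp_all only: finite_field_power_card_minus_1 not_False_eq_True)
  moreover have "dickson (CARD('a) - 1) (b + a + (b - a))
      - (b + a) ^ (CARD('a) - 1) - (b - a) ^ (CARD('a) - 1) = 0"
    using dickson_dvd[of 0 "b + a" "b - a" "CARD('a) - 1"] 1 by simp
  moreover have "b + a + (b - a) = 2 * b" by simp
  ultimately show ?thesis by (metis add_diff_cancel_right' diff_diff_eq eq_iff_diff_eq_0 one_add_one)
qed

text \<open>The Frobenius map conjugates \<open>b + \<surd>s\<close> to its inverse \<open>b - \<surd>s\<close>; the
  computation takes place in the polynomial ring modulo \<open>X\<^sup>2 - s\<close>.\<close>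

lemma dickson_eq_2_of_nonsquare:
  fixes b s :: "'a::finite_field"
  assumes b: "b\<^sup>2 = s + 1" and nonsquare: "\<not> (\<exists>y. s = y\<^sup>2)"
    and p: "prime CARD('a)" "odd CARD('a)"
  shows "dickson (CARD('a) + 1) (2 * b) = 2"
proof -
  define q where "q = [:- s, 0, 1:]"
  define X where "X = [:0, 1 :: 'a:]"
  define v w where "v = [:b:] + X" and "w = [:b:] - X"
  let ?p = "CARD('a)"
  obtain k where k: "?p = 2 * k + 1" using p by (elim oddE)
  have q: "X\<^sup>2 - [:s:] = q" by (simp add: q_def X_def power2_eq_square)
  have "q dvd (X\<^sup>2) ^ k - [:s:] ^ k"
    unfolding q[symmetric] by (simp add: power_diff_sumr2)
  moreover have "[:s:] ^ k = - 1"
    using nonsquare_power_half[OF nonsquare k] by (simp add: poly_const_pow one_pCons)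
  \<comment> \<open>Modulo \<open>q\<close>, \<open>X ^ (2 * k) = s ^ k = -1\<close>, so Frobenius
    sends \<open>X\<close> to \<open>- X\<close> and exchanges \<open>v\<close> and
    \<open>w\<close>.\<close>
  ultimately have "q dvd X * (X ^ (2 * k) + 1)"
    by (simp add: power_mult)
  then have qX: "q dvd X ^ ?p + X" by (simp add: k algebra_simps)
  have CHAR: "CHAR('a poly) = ?p"
    using finite_field_CHAR_eq_CARD p by simp
  have const: "[:b:] ^ ?p = [:b:]"
    by (simp add: poly_const_pow finite_field_power_card_eq_same)
  have frobenius: "(x + y) ^ ?p = x ^ ?p + y ^ ?p" for x y :: "'a poly"
    by (rule freshmans_dream) (simp_all only: CHAR p)
  have "v ^ ?p = [:b:] + X ^ ?p"
    by (simp only: v_def frobenius const)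
  then have vp: "v ^ ?p - w = X ^ ?p + X" by (simp add: w_def)
  have "w ^ ?p = [:b:] + (- X) ^ ?p"
    by (simp only: w_def frobenius const diff_conv_add_uminus)
  then have wp: "w ^ ?p - v = - (X ^ ?p + X)" using p by (simp add: v_def)
  have "v * w - 1 = - q"
    using b by (simp add: v_def w_def X_def q_def power2_eq_square one_pCons)
  then have vw: "q dvd v * w - 1" by simp
  have "v ^ (?p + 1) - 1 = v * (X ^ ?p + X) + (v * w - 1)"
    unfolding vp[symmetric] by (simp add: algebra_simps)
  then have v1: "q dvd v ^ (?p + 1) - 1" using vw qX by (metis dvd_add dvd_mult)
  have "w ^ (?p + 1) - 1 = w * (- (X ^ ?p + X)) + (v * w - 1)"
    unfolding wp[symmetric] by (simp add: algebra_simps)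
  then have w1: "q dvd w ^ (?p + 1) - 1"
    using vw qX by (metis dvd_add dvd_minus_iff dvd_mult)
  have "q dvd dickson (?p + 1) (v + w) - v ^ (?p + 1) - w ^ (?p + 1)"
    using vw by (rule dickson_dvd)
  then have "q dvd (dickson (?p + 1) (v + w) - v ^ (?p + 1) - w ^ (?p + 1))
      + (v ^ (?p + 1) - 1) + (w ^ (?p + 1) - 1)"
    using v1 w1 dvd_add by blast
  then have "q dvd dickson (?p + 1) (v + w) - 2"
    by (simp add: algebra_simps)
  moreover have "v + w = [:2 * b:]" by (simp add: v_def w_def numeral_poly mult.commute)
  ultimately have "q dvd [:dickson (?p + 1) (2 * b) - 2:]"
    by (simp add: dickson_const_poly numeral_poly del: dickson.simps)
  \<comment> \<open>The quadratic \<open>q\<close> divides a constant only if that constant is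
    0.\<close>
  then have "[:dickson (?p + 1) (2 * b) - 2:] = 0"
    using divides_degree[of q "[:dickson (?p + 1) (2 * b) - 2:]"] by (auto simp: q_def)
  then show ?thesis by simp
qed

section \<open>Order and periodicity of Dickson values\<close>

lemma dickson_order_exists:
  fixes x :: "'a::idom"
  assumes "m > 0" and "dickson m x = 2"
  shows "\<exists>d>0. \<forall>k. dickson k x = 2 \<longleftrightarrow> d dvd k"
proof -
  define d where "d = (LEAST d. d > 0 \<and> dickson d x = 2)"
  have d: "d > 0" "dickson d x = 2"
    using LeastI[of "\<lambda>d. d > 0 \<and> dickson d x = 2" m] assms unfolding d_def by auto
  have multiple: "dickson (q * d) x = 2" for q
    using d by (simp add: dickson_mult)
  have "d dvd k" if k: "dickson k x = 2" for k
  proof (rule ccontr)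
    assume "\<not> d dvd k"
    then have mod: "0 < k mod d" "k mod d < d" using d by (auto simp: dvd_eq_mod_eq_0)
    have "(dickson k x - dickson (k div d * d) x)\<^sup>2
        = (dickson (k + k div d * d) x - 2) * (dickson (k - k div d * d) x - 2)"
      by (rule dickson_diff_square) simp
    \<comment> \<open>The values at the sum and the difference of the two indices add up to 4, and
      by the square identity one of them is 2; hence both are.\<close>
    moreover have "dickson k x * dickson (k div d * d) x
        = dickson (k + k div d * d) x + dickson (k - k div d * d) x"
      by (rule dickson_mult_dickson) simp
    ultimately have "dickson (k mod d) x = 2"
      using k multiple by (auto simp: minus_div_mult_eq_mod eq_diff_eq)
    then have "d \<le> k mod d"
      unfolding d_def using mod by (intro Least_le) (simp add: d_def)
    with mod show False by simp
  qed
  with d multiple show ?thesis by (metis dvd_def mult.commute)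
qed

lemma dickson_cong:
  fixes x :: "'a::idom"
  assumes "dickson d x = 2" and "[a = b] (mod d)"
  shows "dickson a x = dickson b x"
proof -
  have *: "dickson a x = dickson b x" if "a \<le> b" "[a = b] (mod d)" for a b
  proof -
    have "d dvd b - a"
      using that by (simp add: cong_def flip: mod_eq_dvd_iff_nat)
    then obtain q where "b - a = q * d" by (metis dvd_def mult.commute)
    then have "dickson (b - a) x = 2"
      using assms by (simp add: dickson_mult)
    then show ?thesis
      using dickson_diff_square[of a b x] that by simp
  qed
  show ?thesis
    using *[of a b] *[of b a] assms(2) by (metis cong_sym nat_le_linear)
qed

lemma coprime_imp_not_dvd_nat:
  fixes d k :: nat
  assumes "coprime d k" and "d > 1"
  shows "\<not> d dvd k"
  using assms by (metis coprime_absorb_left less_irrefl nat_dvd_1_iff_1)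

subsection \<open>Small residues of the multiples of a unit\<close>

text \<open>Legendre's sieve. Adding a prime \<open>q\<close> removes the numbers
  \<open>q * k\<close> with \<open>k\<close> in the previous sifted set up to \<open>x / q\<close>,
  which at most doubles the error; the bound \<open>x\<close> is real to allow this
  division.\<close>

lemma sieve_bound:
  fixes P :: "nat set"
  assumes "finite P" and "\<And>p. p \<in> P \<Longrightarrow> prime p" and "x \<ge> 0"
  shows "\<bar>real (card {n. 0 < n \<and> real n \<le> x \<and> (\<forall>p\<in>P. \<not> p dvd n)})
           - x * (\<Prod>p\<in>P. 1 - 1 / real p)\<bar> \<le> 2 ^ card P"
  using assms
proof (induction P arbitrary: x rule: finite_induct)
  case empty
  have "{n. 0 < n \<and> real n \<le> x} = {0<..nat \<lfloor>x\<rfloor>}"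
    by (auto simp: le_nat_floor) linarith
  then show ?case using empty by simp linarith
next
  case (insert q P)
  define A where "A Q y = {n. 0 < n \<and> real n \<le> y \<and> (\<forall>p\<in>Q. \<not> p dvd n)}" for Q :: "nat set" and y
  have fin: "finite (A Q y)" for Q y
    by (rule finite_subset[of _ "{..nat \<lfloor>y\<rfloor>}"]) (auto simp: A_def le_nat_floor)
  have q: "prime q" "q > 0" using insert.prems by (auto simp: prime_gt_0_nat)
  have *: "p dvd q * n \<longleftrightarrow> p dvd n" if "p \<in> P" for p n
    using that insert.prems insert.hyps q by (metis insertCI prime_dvd_mult_eq_nat primes_dvd_imp_eq)
  have "A P x = A (insert q P) x \<union> (*) q ` A P (x / real q)"
  proof (intro equalityI subsetI)
    fix n assume n: "n \<in> A P x"
    show "n \<in> A (insert q P) x \<union> (*) q ` A P (x / real q)"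
    proof (cases "q dvd n")
      case True
      then obtain k where k: "n = q * k" by blast
      then have "k \<in> A P (x / real q)"
        using n q by (auto simp: A_def * pos_le_divide_eq mult.commute[of _ "real q"])
      with k show ?thesis by blast
    qed (use n in \<open>auto simp: A_def\<close>)
  qed (use q in \<open>auto simp: A_def * pos_le_divide_eq mult.commute[of _ "real q"]\<close>)
  moreover have "A (insert q P) x \<inter> (*) q ` A P (x / real q) = {}"
    by (auto simp: A_def)
  ultimately have "card (A P x) = card (A (insert q P) x) + card ((*) q ` A P (x / real q))"
    using fin by (simp add: card_Un_disjoint)
  moreover have "card ((*) q ` A P (x / real q)) = card (A P (x / real q))"
    using q by (intro card_image) (auto simp: inj_on_def)
  ultimately have card: "real (card (A (insert q P) x)) = real (card (A P x)) - real (card (A P (x / real q)))"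
    by simp
  define w where "w = (\<Prod>p\<in>P. 1 - 1 / real p)"
  have "\<bar>real (card (A P x)) - x * w\<bar> \<le> 2 ^ card P"
    and "\<bar>real (card (A P (x / real q))) - x / real q * w\<bar> \<le> 2 ^ card P"
    unfolding w_def A_def using insert.IH[of x] insert.IH[of "x / real q"] insert.prems by auto
  moreover have "x * ((1 - 1 / real q) * w) = x * w - x / real q * w"
    by (simp add: algebra_simps)
  ultimately have "\<bar>real (card (A (insert q P) x)) - x * ((1 - 1 / real q) * w)\<bar> \<le> 2 * 2 ^ card P"
    unfolding card by linarith
  then show ?case
    using insert.hyps by (simp add: w_def A_def)
qed

lemma card_coprime_ge:
  assumes "d > 0"
  shows "real h * real (totient d) / real d - 2 ^ card (prime_factors d)
           \<le> real (card {n. 0 < n \<and> n \<le> h \<and> coprime n d})"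
proof -
  have "coprime n d \<longleftrightarrow> (\<forall>p\<in>prime_factors d. \<not> p dvd n)" for n
  proof
    assume "coprime n d"
    then show "\<forall>p\<in>prime_factors d. \<not> p dvd n"
      by (metis coprime_common_divisor not_prime_unit in_prime_factors_imp_dvd
          in_prime_factors_imp_prime)
  next
    assume *: "\<forall>p\<in>prime_factors d. \<not> p dvd n"
    show "coprime n d"
    proof (rule ccontr)
      assume "\<not> coprime n d"
      then obtain p where "prime p" "p dvd gcd n d"
        using prime_factor_nat coprime_iff_gcd_eq_1 by blast
      with * assms show False by (auto simp: prime_factors_dvd)
    qed
  qed
  then have "{n. 0 < n \<and> n \<le> h \<and> coprime n d}
      = {n. 0 < n \<and> real n \<le> real h \<and> (\<forall>p\<in>prime_factors d. \<not> p dvd n)}"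
    by auto
  moreover have "real h * real (totient d) / real d = real h * (\<Prod>p\<in>prime_factors d. 1 - 1 / real p)"
    using assms by (simp add: totient_formula2)
  moreover have "\<bar>real (card {n. 0 < n \<and> real n \<le> real h \<and> (\<forall>p\<in>prime_factors d. \<not> p dvd n)})
      - real h * (\<Prod>p\<in>prime_factors d. 1 - 1 / real p)\<bar> \<le> 2 ^ card (prime_factors d)"
    by (rule sieve_bound) auto
  ultimately show ?thesis by (simp only: abs_le_iff) linarith
qed

text \<open>Every prime factor of \<open>d\<close> other than 3 is at least 4; the extra factor 4
  pays for the prime 3.\<close>

lemma four_power_card_prime_factors_le:
  fixes d :: nat
  assumes "odd d"
  shows "4 ^ card (prime_factors d) \<le> 4 * d"
proof -
  let ?P = "prime_factors d"
  have d: "d > 0" using assms by (rule odd_pos)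
  have ge: "p \<ge> 4" if "p \<in> ?P - {3}" for p
  proof -
    have "p \<noteq> 2" "prime p" using that assms by auto
    then show ?thesis using that prime_ge_2_nat[of p] by auto
  qed
  have "card ?P \<le> Suc (card (?P - {3}))"
    by (simp add: card_Diff_singleton_if) arith
  then have "(4 :: nat) ^ card ?P \<le> 4 ^ Suc (card (?P - {3}))"
    by (intro power_increasing) auto
  also have "\<dots> = 4 * (\<Prod>p\<in>?P - {3}. 4)" by simp
  also have "\<dots> \<le> 4 * (\<Prod>p\<in>?P - {3}. p ^ multiplicity p d)"
  proof (intro mult_left_mono prod_mono conjI)
    fix p assume p: "p \<in> ?P - {3}"
    then have "p ^ 1 \<le> p ^ multiplicity p d"
      using ge[OF p] by (intro power_increasing) (auto simp: prime_factors_multiplicity Suc_le_eq)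
    then show "4 \<le> p ^ multiplicity p d" using ge[OF p] by simp
  qed auto
  also have "(\<Prod>p\<in>?P - {3}. p ^ multiplicity p d) dvd (\<Prod>p\<in>?P. p ^ multiplicity p d)"
    by (intro prod_dvd_prod_subset) auto
  then have "4 * (\<Prod>p\<in>?P - {3}. p ^ multiplicity p d) \<le> 4 * d"
    using d by (intro mult_left_mono dvd_imp_le) (auto simp flip: prime_factorization_nat)
  finally show ?thesis .
qed

lemma two_power_card_prime_factors_le:
  assumes "odd d"
  shows "2 ^ card (prime_factors d) \<le> 2 * sqrt (real d)"
proof (rule power2_le_imp_le)
  have "(2 ^ card (prime_factors d))\<^sup>2 = real (4 ^ card (prime_factors d))"
    by (simp add: power_mult[symmetric] mult.commute[of _ 2]) (simp add: power_mult)
  also have "\<dots> \<le> real (4 * d)"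
    using four_power_card_prime_factors_le[OF assms] by (simp only: of_nat_le_iff)
  finally show "(2 ^ card (prime_factors d))\<^sup>2 \<le> (2 * sqrt (real d))\<^sup>2"
    by (simp add: power_mult_distrib)
qed auto

lemma bij_betw_totatives_mult:
  assumes "d > 1" and "coprime u d"
  shows "bij_betw (\<lambda>r. r * u mod d) (totatives d) (totatives d)"
proof -
  have inj: "inj_on (\<lambda>r. r * u mod d) (totatives d)"
  proof (rule inj_onI)
    fix r r' assume r: "r \<in> totatives d" "r' \<in> totatives d" and "r * u mod d = r' * u mod d"
    then have "[r = r'] (mod d)"
      using assms by (simp add: cong_def[symmetric] cong_mult_rcancel_nat coprime_commute)
    then show "r = r'"
      using r assms totatives_less[of r d] totatives_less[of r' d] by (simp add: cong_def)
  qed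
  have "r * u mod d \<in> totatives d" if "r \<in> totatives d" for r
  proof -
    have "coprime (r * u mod d) d"
      using that assms by (simp add: totatives_def)
    moreover from this have "r * u mod d \<noteq> 0"
      using assms by (metis coprime_0_left_iff less_irrefl nat_dvd_1_iff_1)
    ultimately show ?thesis using assms by (simp add: totatives_def less_imp_le)
  qed
  then have "(\<lambda>r. r * u mod d) ` totatives d = totatives d"
    using inj by (intro endo_inj_surj) auto
  then show ?thesis
    using inj by (simp add: bij_betw_def)
qed

text \<open>Double counting: for each \<open>j\<close>, multiplication by \<open>u j\<close>
  permutes the units, so every small unit is hit by exactly one \<open>r\<close>. Some
  \<open>r\<close> does at least as well as the average.\<close>

lemma exists_totative_many_small_residues:
  assumes d: "d > 1" and u: "\<And>j. j < J \<Longrightarrow> coprime (u j) d" and "h < d"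
  shows "\<exists>r\<in>totatives d. J * card {n. 0 < n \<and> n \<le> h \<and> coprime n d}
           \<le> totient d * card {j. j < J \<and> r * u j mod d \<le> h}"
proof (rule ccontr)
  define H where "H = {n. 0 < n \<and> n \<le> h \<and> coprime n d}"
  define c where "c r = card {j. j < J \<and> r * u j mod d \<le> h}" for r
  assume "\<not> ?thesis"
  then have less: "totient d * c r < J * card H" if "r \<in> totatives d" for r
    using that by (auto simp: H_def c_def not_le)
  have "card {r \<in> totatives d. r * u j mod d \<le> h} = card H" if "j < J" for j
  proof -
    have bij: "bij_betw (\<lambda>r. r * u j mod d) (totatives d) (totatives d)"
      using bij_betw_totatives_mult d u that by blast
    have "(\<lambda>r. r * u j mod d) ` {r \<in> totatives d. r * u j mod d \<le> h} = {n \<in> totatives d. n \<le> h}"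
      using bij by (auto simp: bij_betw_def)
    also have "\<dots> = H" using \<open>h < d\<close> by (auto simp: H_def totatives_def)
    finally show ?thesis
      using bij by (metis (no_types, lifting) bij_betw_def card_image inj_on_subset mem_Collect_eq subsetI)
  qed
  then have "J * card H = (\<Sum>j<J. card {r \<in> totatives d. r * u j mod d \<le> h})"
    by simp
  also have "\<dots> = (\<Sum>j<J. \<Sum>r\<in>totatives d. if r * u j mod d \<le> h then 1 else 0)"
    by (simp add: sum.If_cases Int_def)
  also have "\<dots> = (\<Sum>r\<in>totatives d. \<Sum>j<J. if r * u j mod d \<le> h then 1 else 0)"
    by (rule sum.swap)
  also have "\<dots> = (\<Sum>r\<in>totatives d. c r)"
    by (simp add: sum.If_cases Int_def c_def)
  finally have "totient d * (J * card H) = (\<Sum>r\<in>totatives d. totient d * c r)"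
    by (simp add: sum_distrib_left)
  also have "\<dots> < (\<Sum>r\<in>totatives d. J * card H)"
    using d less by (intro sum_strict_mono) auto
  finally show False by (simp add: totient_def)
qed

subsection \<open>Linear recurrences\<close>

lemma homogeneous_system_nontrivial_solution:
  fixes A :: "'b \<Rightarrow> nat \<Rightarrow> 'a::field"
  assumes "finite R" and "L < card R"
  shows "\<exists>c. (\<exists>j\<in>R. c j \<noteq> 0) \<and> (\<forall>i<L. (\<Sum>j\<in>R. c j * A j i) = 0)"
  using assms
proof (induction L arbitrary: R A)
  case 0
  then have "R \<noteq> {}" by auto
  then show ?case by (intro exI[of _ "\<lambda>_. 1"]) auto
next
  case (Suc L)
  show ?case
  proof (cases "\<forall>j\<in>R. A j L = 0")
    case True
    obtain c where "\<exists>j\<in>R. c j \<noteq> 0" "\<forall>i<L. (\<Sum>j\<in>R. c j * A j i) = 0"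
      using Suc.IH[of R A] Suc.prems by auto
    with True show ?thesis by (intro exI[of _ c]) (auto simp: less_Suc_eq)
  next
    case False
    then obtain k where k: "k \<in> R" "A k L \<noteq> 0" by blast
    define B where "B j i = A j i - A j L / A k L * A k i" for j i
    have "L < card (R - {k})" using Suc.prems k by simp
    then obtain c where c: "\<exists>j\<in>R - {k}. c j \<noteq> 0" "\<forall>i<L. (\<Sum>j\<in>R - {k}. c j * B j i) = 0"
      using Suc.IH[of "R - {k}" B] Suc.prems by auto
    \<comment> \<open>The unknown at the pivot \<open>k\<close> is chosen so that equation
      \<open>L\<close> holds.\<close>
    define c' where "c' = c(k := - (\<Sum>j\<in>R - {k}. c j * (A j L / A k L)))"
    have "(\<Sum>j\<in>R. c' j * A j i) = (\<Sum>j\<in>R - {k}. c j * B j i)" for i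
    proof -
      have "(\<Sum>j\<in>R. c' j * A j i) = c' k * A k i + (\<Sum>j\<in>R - {k}. c' j * A j i)"
        using k Suc.prems by (intro sum.remove) auto
      also have "(\<Sum>j\<in>R - {k}. c' j * A j i) = (\<Sum>j\<in>R - {k}. c j * A j i)"
        by (intro sum.cong) (auto simp: c'_def)
      also have "c' k * A k i = - (\<Sum>j\<in>R - {k}. c j * (A j L / A k L * A k i))"
        by (simp add: c'_def sum_distrib_right mult.assoc)
      finally show ?thesis by (simp add: B_def right_diff_distrib sum_subtractf)
    qed
    moreover have "B j L = 0" for j using k by (simp add: B_def)
    moreover have "\<exists>j\<in>R. c' j \<noteq> 0" using c by (auto simp: c'_def)
    ultimately show ?thesis
      using c by (intro exI[of _ c']) (auto simp: less_Suc_eq)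
  qed
qed

text \<open>The coefficients depend on \<open>j\<close> but not on \<open>n\<close>: each shift of
  the sequence lies in the span of the first \<open>L\<close> shifts. For \<open>j \<ge> L\<close>,
  the recurrence reduces it to smaller shifts.\<close>

lemma linear_recurrence_expand:
  assumes "has_linear_recurrence s N L"
  shows "\<exists>A. \<forall>n. n + j < N \<longrightarrow> s (n + j) = (\<Sum>i<L. A i * s (n + i))"
proof (induction j rule: less_induct)
  case (less j)
  obtain a where a: "\<And>n. n + L < N \<Longrightarrow> s (n + L) = (\<Sum>i<L. a i * s (n + i))"
    using assms by (auto simp: has_linear_recurrence_def)
  show ?case
  proof (cases "j < L")
    case True
    then show ?thesis
      by (intro exI[of _ "\<lambda>i. if i = j then 1 else 0"]) (simp add: if_distrib[of "\<lambda>x. x * _"] cong: if_cong)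
  next
    case False
    then have "\<exists>A. \<forall>n. n + (j - L + i) < N \<longrightarrow> s (n + (j - L + i)) = (\<Sum>k<L. A k * s (n + k))"
      if "i < L" for i
      using that by (intro less) auto
    then obtain A where A: "\<And>i n. i < L \<Longrightarrow> n + (j - L + i) < N \<Longrightarrow>
        s (n + (j - L + i)) = (\<Sum>k<L. A i k * s (n + k))"
      by metis
    have "s (n + j) = (\<Sum>k<L. (\<Sum>i<L. a i * A i k) * s (n + k))" if "n + j < N" for n
    proof -
      have "s (n + j) = (\<Sum>i<L. a i * s (n + (j - L + i)))"
        using a[of "n + (j - L)"] that False by (simp add: add.assoc)
      also have "\<dots> = (\<Sum>i<L. a i * (\<Sum>k<L. A i k * s (n + k)))"
        using that False by (intro sum.cong refl arg_cong2[where f = "(*)"] A) auto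
      also have "\<dots> = (\<Sum>i<L. \<Sum>k<L. a i * A i k * s (n + k))"
        by (simp add: sum_distrib_left mult.assoc)
      also have "\<dots> = (\<Sum>k<L. \<Sum>i<L. a i * A i k * s (n + k))"
        by (rule sum.swap)
      finally show ?thesis by (simp add: sum_distrib_right)
    qed
    then show ?thesis by (intro exI[of _ "\<lambda>k. \<Sum>i<L. a i * A i k"]) simp
  qed
qed

text \<open>More than \<open>L\<close> vectors in a space spanned by \<open>L\<close> shifts are
  dependent.\<close>

lemma linear_recurrence_dependence:
  fixes s :: "nat \<Rightarrow> 'a::field"
  assumes "has_linear_recurrence s N L" and "finite R" and "L < card R"
  shows "\<exists>c. (\<exists>j\<in>R. c j \<noteq> 0) \<and>
    (\<forall>n. (\<forall>j\<in>R. n + j < N) \<longrightarrow> (\<Sum>j\<in>R. c j * s (n + j)) = 0)"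
proof -
  obtain A where A: "\<And>j n. n + j < N \<Longrightarrow> s (n + j) = (\<Sum>i<L. A j i * s (n + i))"
    using linear_recurrence_expand[OF assms(1)] by metis
  obtain c where c: "\<exists>j\<in>R. c j \<noteq> 0" "\<forall>i<L. (\<Sum>j\<in>R. c j * A j i) = 0"
    using homogeneous_system_nontrivial_solution[OF assms(2,3)] by blast
  have "(\<Sum>j\<in>R. c j * s (n + j)) = 0" if "\<forall>j\<in>R. n + j < N" for n
  proof -
    have "(\<Sum>j\<in>R. c j * s (n + j)) = (\<Sum>j\<in>R. \<Sum>i<L. c j * A j i * s (n + i))"
      using that by (intro sum.cong refl) (simp add: A sum_distrib_left mult.assoc)
    also have "\<dots> = (\<Sum>i<L. (\<Sum>j\<in>R. c j * A j i) * s (n + i))"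
      by (subst sum.swap) (simp add: sum_distrib_right)
    finally show ?thesis using c by simp
  qed
  with c show ?thesis by blast
qed

lemma linear_recurrence_antimono:
  "has_linear_recurrence s N L \<Longrightarrow> M \<le> N \<Longrightarrow> has_linear_recurrence s M L"
  unfolding has_linear_recurrence_def by (meson less_le_trans)

lemma linear_complexity_recurrence:
  "has_linear_recurrence s N (linear_complexity s N)"
  unfolding linear_complexity_def
  \<comment> \<open>The length \<open>N\<close> satisfies the condition vacuously, so the minimum
    exists.\<close>
  by (rule LeastI[of _ N]) (simp add: has_linear_recurrence_def)

lemma inj_on_seq_period: "inj_on s {..<seq_period s}"
proof (rule linorder_inj_onI)
  fix i j assume "i < j" "j \<in> {..<seq_period s}"
  then have j: "j < first_repetition s" by (simp add: seq_period_def)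
  show "s i \<noteq> s j"
  proof
    assume "s i = s j"
    then have "s j \<in> s ` {..<j}" using \<open>i < j\<close> by (metis imageI lessThan_iff)
    then have "first_repetition s \<le> j"
      unfolding first_repetition_def using \<open>i < j\<close> by (intro Least_le) auto
    with j show False by simp
  qed
qed auto

text \<open>Among the terms with nonzero coefficient, the one of largest degree has a leading term
  that nothing cancels.\<close>

lemma coeff_zero_of_distinct_degrees:
  fixes f :: "'b \<Rightarrow> 'a::idom poly"
  assumes "finite R" and inj: "inj_on (\<lambda>j. degree (f j)) R" and f: "\<And>j. j \<in> R \<Longrightarrow> f j \<noteq> 0"
    and sum: "(\<Sum>j\<in>R. smult (c j) (f j)) = 0" and "j \<in> R"
  shows "c j = 0"
proof (rule ccontr)
  assume "c j \<noteq> 0"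
  define Q where "Q = {j \<in> R. c j \<noteq> 0}"
  have "finite Q" "Q \<noteq> {}" using assms \<open>c j \<noteq> 0\<close> by (auto simp: Q_def)
  then have "Max ((\<lambda>j. degree (f j)) ` Q) \<in> (\<lambda>j. degree (f j)) ` Q"
    by (intro Max_in) auto
  then obtain k where "k \<in> Q" and "Max ((\<lambda>j. degree (f j)) ` Q) = degree (f k)"
    by auto
  then have k: "k \<in> Q" "\<And>i. i \<in> Q \<Longrightarrow> degree (f i) \<le> degree (f k)"
    using \<open>finite Q\<close> by (auto simp flip: \<open>Max _ = _\<close>)
  have "coeff (smult (c i) (f i)) (degree (f k)) = 0" if "i \<in> R - {k}" for i
  proof (cases "c i = 0")
    case False
    then have "degree (f i) \<le> degree (f k)" "degree (f i) \<noteq> degree (f k)"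
      using k that inj by (auto simp: Q_def inj_on_def)
    then show ?thesis by (simp add: coeff_eq_0)
  qed simp
  then have "(\<Sum>i\<in>R - {k}. coeff (smult (c i) (f i)) (degree (f k))) = 0"
    by (intro sum.neutral) blast
  then have "coeff (\<Sum>j\<in>R. smult (c j) (f j)) (degree (f k)) = c k * lead_coeff (f k)"
    using k \<open>finite R\<close> by (subst coeff_sum, subst sum.remove[of _ k]) (auto simp: Q_def)
  then show False using sum k f by (auto simp: Q_def)
qed

subsection \<open>The orbit of the logistic map\<close>

context
  fixes s :: "nat \<Rightarrow> 'a::field" and \<xi> :: 'a and d :: nat
  assumes dickson_order: "\<And>k. dickson k \<xi> = 2 \<longleftrightarrow> d dvd k"
    and d: "odd d" "d > 1"
    and four: "(4 :: 'a) \<noteq> 0"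
    and s: "\<And>n. 4 * s n + 2 = dickson (2 ^ n) \<xi>"
begin

lemma seq_eq_of_cong:
  assumes "[2 ^ i = 2 ^ j] (mod d)"
  shows "s i = s j"
proof -
  have "4 * s i + 2 = 4 * s j + 2"
    using assms unfolding s by (intro dickson_cong[where d = d]) (auto simp: dickson_order)
  with four show ?thesis by simp
qed

lemma inj_on_power_two_mod:
  assumes "inj_on s A"
  shows "inj_on (\<lambda>i. 2 ^ i mod d) A"
  by (rule inj_onI) (metis assms cong_def inj_onD seq_eq_of_cong)

text \<open>Distinct terms come from distinct residues of powers of 2, all units since
  \<open>d\<close> is odd.\<close>

lemma distinct_terms_le_totient:
  assumes "inj_on s {..<T}"
  shows "T \<le> totient d"
proof -
  have "(\<lambda>i. 2 ^ i mod d) ` {..<T} \<subseteq> totatives d"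
    using d coprime_imp_not_dvd_nat[of d "2 ^ i" for i]
    by (auto simp: totatives_def mod_greater_zero_iff_not_dvd less_imp_le)
  then have "card ((\<lambda>i. 2 ^ i mod d) ` {..<T}) \<le> totient d"
    unfolding totient_def by (intro card_mono) auto
  then show ?thesis
    using inj_on_power_two_mod[OF assms] by (simp add: card_image)
qed

text \<open>More than \<open>L\<close> small residues \<open>y\<close> would give a nontrivial linear combination of
  the polynomials \<open>V\<^sub>y(X) - 2\<close>, of degree at most \<open>h\<close>, that vanishes at \<open>X = 2\<close> and at the
  \<open>h\<close> points \<open>X = V\<^sub>k(\<xi>)\<close>, \<open>k = r' 2\<^sup>n\<close>, where \<open>r r' = 1\<close> modulo \<open>d\<close>.\<close>

lemma card_small_residues_le:
  assumes inj: "inj_on s {..<T}" and h: "h \<le> T" and J: "J \<le> T" and N: "J + h \<le> N"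
    and rec: "has_linear_recurrence s N L" and r: "coprime r d"
  shows "card {j. j < J \<and> r * 2 ^ j mod d \<le> h} \<le> L"
proof (rule ccontr)
  define R where "R = {j. j < J \<and> r * 2 ^ j mod d \<le> h}"
  define y where "y j = r * 2 ^ j mod d" for j
  define f where "f j = dickson (y j) ([:0, 1:] :: 'a poly) - 2" for j
  have fin: "finite R" by (simp add: R_def)
  assume "\<not> ?thesis"
  then obtain c where c: "\<exists>j\<in>R. c j \<noteq> 0"
    and c_sum: "\<And>n. \<forall>j\<in>R. n + j < N \<Longrightarrow> (\<Sum>j\<in>R. c j * s (n + j)) = 0"
    using linear_recurrence_dependence[OF rec fin] by (auto simp: R_def)
  define P where "P = (\<Sum>j\<in>R. smult (c j) (f j))"
  obtain r' where r': "[r * r' = 1] (mod d)"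
    using cong_solve_coprime_nat[OF r] by auto
  have y_pos: "y j > 0" for j
  proof (rule Nat.gr0I)
    assume "y j = 0"
    then have "d dvd r * 2 ^ j" by (simp add: y_def mod_eq_0_iff_dvd)
    moreover have "coprime d (r * 2 ^ j)" using r d by (simp add: coprime_commute)
    ultimately show False using d coprime_imp_not_dvd_nat by blast
  qed
  have "(2 :: 'a) \<noteq> 0" using four by (metis mult_2 add_0 numeral_Bit0 one_add_one)
  then have deg: "degree (f j) = y j" for j
    using degree_dickson_X[where ?'a = 'a, of "y j"] y_pos[of j] unfolding f_def diff_conv_add_uminus
    by (subst degree_add_eq_left) auto
  have "inj_on y R"
  proof (rule inj_onI)
    fix i j assume ij: "i \<in> R" "j \<in> R" "y i = y j"
    then have "[2 ^ i = 2 ^ j] (mod d)"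
      using r by (simp add: y_def cong_def[symmetric] cong_mult_lcancel_nat coprime_commute)
    then have "s i = s j" by (rule seq_eq_of_cong)
    with ij J inj show "i = j" by (auto simp: R_def inj_on_def)
  qed
  then have "inj_on (\<lambda>j. degree (f j)) R" by (simp add: deg)
  moreover have "f j \<noteq> 0" for j using deg[of j] y_pos[of j] by auto
  ultimately have "P \<noteq> 0"
    using coeff_zero_of_distinct_degrees[OF fin, of f c] c unfolding P_def by blast
  have "degree P \<le> h"
    unfolding P_def using deg
    by (intro degree_sum_le fin order.trans[OF degree_smult_le]) (auto simp: R_def y_def)
  \<comment> \<open>Since \<open>y j * r'\<close> is \<open>2 ^ j\<close> modulo \<open>d\<close>,
    evaluating \<open>f j\<close> at these points recovers the shifted terms
    \<open>4 * s (n + j)\<close>.\<close>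
  define \<eta> where "\<eta> n = dickson (r' * 2 ^ n) \<xi>" for n
  have root: "poly P (\<eta> n) = 0" if "n < h" for n
  proof -
    have "poly (f j) (\<eta> n) = 4 * s (n + j)" for j
    proof -
      have "[y j * (r' * 2 ^ n) = r * 2 ^ j * (r' * 2 ^ n)] (mod d)"
        unfolding y_def by (intro cong_mult cong_refl) (simp add: cong_def)
      also have "r * 2 ^ j * (r' * 2 ^ n) = r * r' * 2 ^ (n + j)"
        by (simp add: power_add)
      also have "[r * r' * 2 ^ (n + j) = 1 * 2 ^ (n + j)] (mod d)"
        using r' by (intro cong_mult cong_refl)
      finally have "dickson (y j * (r' * 2 ^ n)) \<xi> = dickson (2 ^ (n + j)) \<xi>"
        by (intro dickson_cong[where d = d]) (auto simp: dickson_order)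
      then show ?thesis
        by (simp add: f_def poly_dickson \<eta>_def dickson_mult flip: s)
    qed
    then have "poly P (\<eta> n) = 4 * (\<Sum>j\<in>R. c j * s (n + j))"
      by (simp add: P_def poly_sum sum_distrib_left mult.left_commute)
    also have "(\<Sum>j\<in>R. c j * s (n + j)) = 0"
      using that N by (intro c_sum) (auto simp: R_def)
    finally show ?thesis by simp
  qed
  have root2: "poly P 2 = 0"
    by (simp add: P_def poly_sum f_def poly_dickson)
  \<comment> \<open>Applying \<open>dickson r\<close> undoes \<open>r'\<close>; hence the
    \<open>h\<close> points are distinct, like the terms \<open>s n\<close>, and none equals
    2.\<close>
  have dickson_\<eta>: "dickson r (\<eta> n) = dickson (2 ^ n) \<xi>" for n
  proof -
    have "[r * (r' * 2 ^ n) = 1 * 2 ^ n] (mod d)"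
      using r' unfolding mult.assoc[symmetric] by (intro cong_mult cong_refl)
    then show ?thesis
      unfolding \<eta>_def dickson_mult[symmetric]
      by (intro dickson_cong[where d = d]) (auto simp: dickson_order)
  qed
  have "inj_on \<eta> {..<h}"
  proof (rule inj_onI)
    fix i j assume ij: "i \<in> {..<h}" "j \<in> {..<h}" "\<eta> i = \<eta> j"
    then have "4 * s i + 2 = 4 * s j + 2" unfolding s by (metis dickson_\<eta>)
    then have "s i = s j" using four by simp
    with ij h inj show "i = j" by (auto simp: inj_on_def)
  qed
  moreover have "2 \<notin> \<eta> ` {..<h}"
  proof
    assume "2 \<in> \<eta> ` {..<h}"
    then obtain n where "\<eta> n = 2" by auto
    then have "dickson (2 ^ n) \<xi> = 2" using dickson_\<eta>[of n] by simp
    then have "d dvd 2 ^ n" by (simp add: dickson_order)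
    moreover have "coprime d (2 ^ n)" using d by simp
    ultimately show False using d coprime_imp_not_dvd_nat by blast
  qed
  ultimately have "card (insert 2 (\<eta> ` {..<h})) = Suc h"
    by (simp add: card_image)
  moreover have "card (insert 2 (\<eta> ` {..<h})) \<le> card {x. poly P x = 0}"
    using \<open>P \<noteq> 0\<close> root root2 by (intro card_mono poly_roots_finite) auto
  moreover have "card {x. poly P x = 0} \<le> degree P"
    using \<open>P \<noteq> 0\<close> by (rule card_poly_roots_bound)
  ultimately show False using \<open>degree P \<le> h\<close> by simp
qed

lemma linear_recurrence_length_ge:
  assumes inj: "inj_on s {..<T}" and N: "N \<le> 2 * T" and rec: "has_linear_recurrence s N L"
  shows "real L \<ge> (real N ^ 2 - 1) / (4 * real d) - 2 * sqrt (real d)"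
proof -
  \<comment> \<open>Near-equal halves maximize the product \<open>J * h\<close>;
    \<open>N \<le> 2 * T\<close> keeps both at most \<open>T\<close>.\<close>
  define h J where "h = N div 2" and "J = N - h"
  have hJ: "h \<le> T" "J \<le> T" "J + h = N" using N by (auto simp: h_def J_def)
  have T: "T \<le> totient d" using inj by (rule distinct_terms_le_totient)
  moreover have "totient d < d" using d by (intro totient_less)
  ultimately have "h < d" using hJ by simp
  define U where "U = card {n. 0 < n \<and> n \<le> h \<and> coprime n d}"
  obtain r where r: "r \<in> totatives d"
    and "J * U \<le> totient d * card {j. j < J \<and> r * 2 ^ j mod d \<le> h}"
    using exists_totative_many_small_residues[of d J "\<lambda>j. 2 ^ j" h] d \<open>h < d\<close> by (auto simp: U_def)
  moreover have "card {j. j < J \<and> r * 2 ^ j mod d \<le> h} \<le> L"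
    using inj hJ rec r by (intro card_small_residues_le[of T h J N]) (auto simp: totatives_def)
  ultimately have "J * U \<le> totient d * L" by (meson le_trans mult_le_mono2)
  then have "real J * real U \<le> real (totient d) * real L"
    by (simp only: of_nat_le_iff flip: of_nat_mult)
  moreover have "real h * real (totient d) / real d - 2 * sqrt (real d) \<le> real U"
    using card_coprime_ge[of d h] two_power_card_prime_factors_le[of d] d unfolding U_def by linarith
  then have "real J * (real h * real (totient d) / real d - 2 * sqrt (real d)) \<le> real J * real U"
    by (intro mult_left_mono) auto
  \<comment> \<open>\<open>J \<le> T \<le> totient d\<close> lets the factor
    \<open>totient d\<close> cancel from the error term as well.\<close>
  moreover have "real J * (2 * sqrt (real d)) \<le> real (totient d) * (2 * sqrt (real d))"
    using hJ T by (intro mult_right_mono) auto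
  ultimately have "real (totient d) * (real J * real h / real d - 2 * sqrt (real d))
      \<le> real (totient d) * real L"
    by (simp add: algebra_simps)
  moreover have "totient d > 0" using d by simp
  ultimately have L: "real J * real h / real d - 2 * sqrt (real d) \<le> real L"
    by simp
  \<comment> \<open>The loss of 1 occurs when \<open>N\<close> is odd.\<close>
  have "(real N)\<^sup>2 - 1 \<le> 4 * (real J * real h)"
  proof (cases "even N")
    case True
    then obtain k where "N = 2 * k" by blast
    then show ?thesis by (simp add: h_def J_def power2_eq_square)
  next
    case False
    then obtain k where "N = 2 * k + 1" by (elim oddE)
    then show ?thesis by (simp add: h_def J_def power2_eq_square algebra_simps)
  qed
  then have "((real N)\<^sup>2 - 1) / (4 * real d) \<le> 4 * (real J * real h) / (4 * real d)"
    by (rule divide_right_mono) simp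
  with L show ?thesis by simp
qed

end

section \<open>From the quadratic characters to the final estimate\<close>

theorem theorem21:
  fixes m p T :: nat and s :: "nat \<Rightarrow> 'a::finite_field"
  assumes "m > 2" and "odd m"
    and "prime p" and "CARD('a) = p"
    and "(p = 2 * m + 1 \<and> s 0 \<in> quad_residues \<inter> set_shift quad_residues 1) \<or>
         (p = 2 * m - 1 \<and> s 0 \<in> quad_nonresidues \<inter> set_shift quad_residues 1)"
    and "\<And>n. s (Suc n) = 4 * s n * (s n + 1)"
    and "T = seq_period s"
  shows "\<forall>N\<ge>1. real (linear_complexity s N)
           \<ge> min (real N ^ 2) (4 * real T ^ 2) / (16 * real m) - sqrt (real m)"
proof (intro allI impI)
  fix N :: nat
  define \<xi> where "\<xi> = 4 * s 0 + 2"
  have p: "prime CARD('a)" "odd CARD('a)" "p > 4"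
    using assms(1-5) by auto
  have "CHAR('a) = p" using finite_field_CHAR_eq_CARD p assms(4) by metis
  then have "of_nat 4 \<noteq> (0 :: 'a)"
    using p by (simp only: of_nat_eq_0_iff_char_dvd) (auto dest: dvd_imp_le)
  then have four: "(4 :: 'a) \<noteq> 0" by simp
  obtain b where b: "b\<^sup>2 = s 0 + 1"
    using assms(5) by (auto simp: set_shift_def quad_residues_def)
  \<comment> \<open>Writing \<open>\<xi>\<close> as a second Dickson value turns the index
    \<open>m\<close> into \<open>2 * m\<close>, which is \<open>p - 1\<close> or
    \<open>p + 1\<close> in the two cases.\<close>
  have "4 * (s 0 + 1) - 2 = dickson 2 (2 * b)"
    by (simp add: dickson_2 power_mult_distrib b)
  then have \<xi>: "dickson 2 (2 * b) = \<xi>" by (simp add: \<xi>_def algebra_simps)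
  have "dickson (m * 2) (2 * b) = 2"
    using assms(5)
  proof (elim disjE conjE)
    assume "p = 2 * m + 1" "s 0 \<in> quad_residues \<inter> set_shift quad_residues 1"
    moreover from this obtain a where "s 0 = a\<^sup>2" by (auto simp: quad_residues_def)
    ultimately show ?thesis
      using dickson_eq_2_of_square[of b a] b assms(4) by (simp add: mult.commute)
  next
    assume "p = 2 * m - 1" "s 0 \<in> quad_nonresidues \<inter> set_shift quad_residues 1"
    then have "dickson (CARD('a) + 1) (2 * b) = 2"
      using p b by (intro dickson_eq_2_of_nonsquare[of b "s 0"]) (auto simp: quad_nonresidues_def)
    moreover have "CARD('a) + 1 = m * 2"
      using assms(1,4) \<open>p = 2 * m - 1\<close> by simp
    ultimately show ?thesis by simp
  qed
  then have "dickson m \<xi> = 2" by (simp only: dickson_mult \<xi>)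
  moreover from this obtain d where d: "d > 0" "\<And>k. dickson k \<xi> = 2 \<longleftrightarrow> d dvd k"
    using dickson_order_exists[of m \<xi>] assms(1) by auto
  ultimately have "d dvd m" by blast
  then have "odd d" "d \<le> m" using assms(1,2) by (auto dest: dvd_trans dvd_imp_le)
  \<comment> \<open>Equivalently \<open>\<xi> \<noteq> 2\<close>, which excludes
    \<open>d = 1\<close>.\<close>
  have "s 0 \<noteq> 0"
    using assms(5) zero_power2[where ?'a = 'a] unfolding quad_residues_def quad_nonresidues_def
    by (metis (mono_tags, lifting) IntD1 mem_Collect_eq)
  then have "dickson 1 \<xi> \<noteq> 2" using four by (simp add: \<xi>_def)
  then have "d > 1" using d by (metis One_nat_def Suc_lessI dvd_refl)
  have s: "4 * s n + 2 = dickson (2 ^ n) \<xi>" for n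
  proof (induction n)
    case (Suc n)
    have "4 * s (Suc n) + 2 = dickson 2 (4 * s n + 2)"
      by (simp add: assms(6) dickson_2 power2_eq_square algebra_simps)
    also have "\<dots> = dickson (2 ^ Suc n) \<xi>"
      by (simp only: Suc.IH power_Suc dickson_mult)
    finally show ?case .
  qed (simp add: \<xi>_def)

  \<comment> \<open>Truncation at \<open>2 * T\<close> keeps both halves of the range within the
    distinct terms.\<close>
  define M where "M = min N (2 * T)"
  define L where "L = linear_complexity s N"
  have min: "min (real N ^ 2) (4 * real T ^ 2) = real M ^ 2"
  proof -
    have "4 * real T ^ 2 = real (2 * T) ^ 2" by (simp add: power_mult_distrib)
    moreover have "real N ^ 2 \<le> real (2 * T) ^ 2 \<longleftrightarrow> N \<le> 2 * T"
      by (subst power_mono_iff) auto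
    ultimately show ?thesis by (simp only: M_def min_def split: if_split) simp
  qed
  have "has_linear_recurrence s M L"
    unfolding L_def using linear_complexity_recurrence
    by (rule linear_recurrence_antimono) (simp add: M_def)
  then have "real L \<ge> (real M ^ 2 - 1) / (4 * real d) - 2 * sqrt (real d)"
    using linear_recurrence_length_ge[OF d(2) \<open>odd d\<close> \<open>d > 1\<close> four s, of T M L]
      inj_on_seq_period[of s] assms(7) by (auto simp: M_def)
  moreover have "sqrt (real d) \<le> sqrt (real m)" using \<open>d \<le> m\<close> by simp
  ultimately have L: "real L \<ge> (real M ^ 2 - 1) / (4 * real d) - 2 * sqrt (real m)"
    by linarith
  show "real (linear_complexity s N)
      \<ge> min (real N ^ 2) (4 * real T ^ 2) / (16 * real m) - sqrt (real m)"
  \<comment> \<open>If \<open>A = M^2 / (16 m)\<close> is at most \<open>sqrt m\<close>, the bound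
    is trivial. Otherwise the loss of 1 still leaves \<open>L \<ge> 3 A - 2 sqrt m\<close>, which
    exceeds \<open>A - sqrt m\<close>.\<close>
  proof (cases "real M ^ 2 / (16 * real m) \<le> sqrt (real m)")
    case True
    then show ?thesis unfolding min by linarith
  next
    case False
    have "1 \<le> sqrt (real m)" using assms(1) by simp
    with False have "1 < real M ^ 2 / (16 * real m)" by linarith
    then have M: "16 * real m < real M ^ 2" using assms(1) by (simp add: field_simps)
    have "3 * real M ^ 2 / (16 * real m) \<le> (real M ^ 2 - 1) / (4 * real m)"
      using M assms(1) by (simp add: field_simps)
    also have "\<dots> \<le> (real M ^ 2 - 1) / (4 * real d)"
      using M assms(1) \<open>d \<le> m\<close> \<open>d > 0\<close> by (intro divide_left_mono) auto
    finally have "3 * (real M ^ 2 / (16 * real m)) \<le> (real M ^ 2 - 1) / (4 * real d)"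
      by simp
    with L False \<open>1 \<le> sqrt (real m)\<close> show ?thesis unfolding min L_def[symmetric] by linarith
  qed
qed

end
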